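(* Let $\mathcal{H}$ be an infinite-dimensional separable complex Hilbert space and let $T$ be a hyponormal bounded linear operator on $\mathcal{H}$, with real part $X_1=\frac{T+T^*}{2}$. Then $T$ has a nontrivial closed reducing subspace if and only if there exists a self-adjoint operator $Q\in\mathcal{S}_T$, different from $0$ and $I$, such that $QX_1=X_1Q$.
   Context: A bounded operator $T$ is hyponormal if $[T^*,T]=T^*T-TT^*$ is positive semi-definite. $\mathcal{L}(\mathcal{H})$ denotes the bounded linear operators on $\mathcal{H}$, $I$ is the identity, and $\mathcal{S}_T=\{Q\in\mathcal{L}(\mathcal{H}) : (I-Q)TQ \text{ is self-adjoint}\}$. A closed subspace $M$ is reducing for $T$ if it is invariant under both $T$ and $T^*$; it is nontrivial if $M\neq\{0\}$ and $M\neq\mathcal{H}$. *)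

theory Defs
  imports "HOL-Analysis.Analysis"
begin

(* A complex inner product space is presented as an expansion of its underlying real inner
   product space, so that norm and topology are those of real_inner. Positive definiteness of
   cinner is inherited from inner through inner_eq_Re_cinner and cinner_commute, and
   1 *\<^sub>C x = x from scaleR_scaleC. The form is linear in its first argument. *)
class complex_inner = real_inner +
  fixes scaleC :: "complex \<Rightarrow> 'a \<Rightarrow> 'a" (infixr "*\<^sub>C" 75)
    and cinner :: "'a \<Rightarrow> 'a \<Rightarrow> complex"
  assumes scaleC_add_right: "a *\<^sub>C (x + y) = a *\<^sub>C x + a *\<^sub>C y"
    and scaleC_add_left: "(a + b) *\<^sub>C x = a *\<^sub>C x + b *\<^sub>C x"
    and scaleC_scaleC: "a *\<^sub>C b *\<^sub>C x = (a * b) *\<^sub>C x"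
    and scaleR_scaleC: "r *\<^sub>R x = complex_of_real r *\<^sub>C x"
    and cinner_commute: "cinner x y = cnj (cinner y x)"
    and cinner_add_left: "cinner (x + y) z = cinner x z + cinner y z"
    and cinner_scaleC_left: "cinner (a *\<^sub>C x) y = a * cinner x y"
    and inner_eq_Re_cinner: "inner x y = Re (cinner x y)"

class chilbert_space = complex_inner + complete_space

interpretation complex_vector: vector_space "scaleC :: complex \<Rightarrow> 'a \<Rightarrow> 'a::complex_inner"
proof
  fix a b :: complex and x y :: 'a
  show "a *\<^sub>C (x + y) = a *\<^sub>C x + a *\<^sub>C y" by (rule scaleC_add_right)
  show "(a + b) *\<^sub>C x = a *\<^sub>C x + b *\<^sub>C x" by (rule scaleC_add_left)
  show "a *\<^sub>C b *\<^sub>C x = (a * b) *\<^sub>C x" by (rule scaleC_scaleC)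
  show "1 *\<^sub>C x = x" using scaleR_scaleC[of 1 x] by simp
qed

lemma cinner_self: "cinner x x = complex_of_real ((norm x)\<^sup>2)" for x :: "'a::complex_inner"
proof (rule complex_eqI)
  show "Re (cinner x x) = Re (complex_of_real ((norm x)\<^sup>2))"
    by (simp add: inner_eq_Re_cinner[symmetric] power2_norm_eq_inner)
  have "Im (cinner x x) = Im (cnj (cinner x x))"
    using cinner_commute[of x x] by simp
  then show "Im (cinner x x) = Im (complex_of_real ((norm x)\<^sup>2))"
    by simp
qed

instantiation complex :: chilbert_space
begin

definition scaleC_complex :: "complex \<Rightarrow> complex \<Rightarrow> complex"
  where "scaleC_complex a x = a * x"

definition cinner_complex :: "complex \<Rightarrow> complex \<Rightarrow> complex"
  where "cinner_complex x y = x * cnj y"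

instance
  by standard
    (simp_all add: scaleC_complex_def cinner_complex_def inner_complex_def
      algebra_simps scaleR_conv_of_real)

end

definition finite_cdim :: "'a::complex_inner itself \<Rightarrow> bool"
  where "finite_cdim _ \<longleftrightarrow> (\<exists>B::'a set. finite B \<and> complex_vector.span B = UNIV)"

definition separable :: "'a::topological_space itself \<Rightarrow> bool"
  where "separable _ \<longleftrightarrow> (\<exists>D::'a set. countable D \<and> closure D = UNIV)"

definition bounded_clinear :: "('a::complex_inner \<Rightarrow> 'a) \<Rightarrow> bool"
  where "bounded_clinear T \<longleftrightarrow> Vector_Spaces.linear scaleC scaleC T \<and> bounded_linear T"

(* Only meaningful for bounded operators on a Hilbert space, where the Riesz representation
   theorem provides the unique such S. *)
definition cadjoint :: "('a::chilbert_space \<Rightarrow> 'a) \<Rightarrow> ('a \<Rightarrow> 'a)"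
  where "cadjoint T = (THE S. \<forall>x y. cinner (T x) y = cinner x (S y))"

definition self_adjoint :: "('a::chilbert_space \<Rightarrow> 'a) \<Rightarrow> bool"
  where "self_adjoint A \<longleftrightarrow> bounded_clinear A \<and> cadjoint A = A"

definition positive_semidefinite :: "('a::chilbert_space \<Rightarrow> 'a) \<Rightarrow> bool"
  where "positive_semidefinite A \<longleftrightarrow>
    bounded_clinear A \<and> (\<forall>x. cinner (A x) x \<in> \<real>\<^sub>\<ge>\<^sub>0)"

definition hyponormal :: "('a::chilbert_space \<Rightarrow> 'a) \<Rightarrow> bool"
  where "hyponormal T \<longleftrightarrow> bounded_clinear T \<and>
    positive_semidefinite (\<lambda>x. cadjoint T (T x) - T (cadjoint T x))"

definition real_part :: "('a::chilbert_space \<Rightarrow> 'a) \<Rightarrow> ('a \<Rightarrow> 'a)"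
  where "real_part T = (\<lambda>x. (1 / 2) *\<^sub>C (T x + cadjoint T x))"

definition S_set :: "('a::chilbert_space \<Rightarrow> 'a) \<Rightarrow> ('a \<Rightarrow> 'a) set"
  where "S_set T = {Q. bounded_clinear Q \<and> self_adjoint ((\<lambda>x. x - Q x) \<circ> T \<circ> Q)}"

definition reducing_subspace :: "('a::chilbert_space \<Rightarrow> 'a) \<Rightarrow> 'a set \<Rightarrow> bool"
  where "reducing_subspace T M \<longleftrightarrow> complex_vector.subspace M \<and> closed M \<and>
    T ` M \<subseteq> M \<and> cadjoint T ` M \<subseteq> M"

end

theory Submission
  imports Defs
begin

text \<open>
  For a reducing subspace take \<open>Q\<close> to be its orthogonal projection. Conversely put \<open>P = 2Q - 1\<close>,
  \<open>X = T + T*\<close> and \<open>W = T - T*\<close>; the hypotheses on \<open>Q\<close> amount to \<open>PX = XP\<close> and \<open>PWP = W\<close>, and they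
  imply that the self-adjoint operator \<open>B = P(1 + P\<^sup>2)\<^sup>-\<^sup>1\<close> commutes with \<open>X\<close> and \<open>W\<close>, hence with
  \<open>T\<close> and \<open>T*\<close>. A self-adjoint operator that is not a scalar has a hyperinvariant subspace, so it
  remains to treat \<open>B = c\<close>. Then \<open>P\<close> satisfies a quadratic equation with mutually inverse roots,
  and \<open>D = T*T - TT*\<close> satisfies \<open>D \<ge> 0\<close> and \<open>PDP = D\<close>. Unless \<open>P = 1\<close> or \<open>P = -1\<close> this forces
  \<open>D = 0\<close>, that is, \<open>T\<close> is normal, and then \<open>X\<close> or \<open>iW\<close> provides the subspace, unless \<open>T\<close> itself
  is a scalar.
\<close>

instance chilbert_space \<subseteq> banach ..

section \<open>Orthogonality and symmetric operators in real Hilbert spaces\<close>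

text \<open>A minimizing sequence is Cauchy by the parallelogram law, because convexity keeps
  midpoints in \<open>C\<close>; completeness and closedness supply its limit.\<close>

lemma closest_point_exists:
  fixes C :: "'a::{real_inner,banach} set"
  assumes "closed C" "convex C" "C \<noteq> {}"
  obtains p where "p \<in> C" "\<And>y. y \<in> C \<Longrightarrow> norm (a - p) \<le> norm (a - y)"
proof -
  define d where "d = (INF y\<in>C. norm (a - y))"
  have bdd: "bdd_below ((\<lambda>y. norm (a - y)) ` C)"
    by (rule bdd_belowI[of _ 0]) auto
  have d_le: "d \<le> norm (a - y)" if "y \<in> C" for y
    unfolding d_def by (rule cINF_lower[OF bdd that])
  have d0: "d \<ge> 0"
    unfolding d_def using assms(3) by (intro cINF_greatest) auto
  have "\<exists>y\<in>C. norm (a - y) < d + 1 / real (Suc n)" for n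
    using cINF_less_iff[OF assms(3) bdd, of "d + 1 / real (Suc n)"]
    by (simp add: d_def)
  then obtain u where u: "\<And>n. u n \<in> C" "\<And>n. norm (a - u n) < d + 1 / real (Suc n)"
    by metis
  have lim: "(\<lambda>n. d + 1 / real (Suc n)) \<longlonglongrightarrow> d"
    using tendsto_add[OF tendsto_const LIMSEQ_Suc[OF lim_1_over_n], of d] by simp
  have norm_lim: "(\<lambda>n. norm (a - u n)) \<longlonglongrightarrow> d"
    by (rule tendsto_sandwich[OF _ _ tendsto_const lim])
      (use d_le u in \<open>auto intro!: always_eventually less_imp_le\<close>)
  \<comment> \<open>Parallelogram law for \<open>a - u m\<close> and \<open>a - u n\<close>: half
    their sum is \<open>a\<close> minus the midpoint of \<open>u m\<close> and \<open>u n\<close>,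
    whose norm is at least \<open>d\<close>.\<close>
  have para: "(norm (u m - u n))\<^sup>2 \<le> 2 * (norm (a - u m))\<^sup>2 + 2 * (norm (a - u n))\<^sup>2 - 4 * d\<^sup>2" for m n
  proof -
    have "(1/2) *\<^sub>R u m + (1/2) *\<^sub>R u n \<in> C"
      by (intro convexD[OF assms(2) u(1) u(1)]) auto
    then have "d \<le> norm (a - ((1/2) *\<^sub>R u m + (1/2) *\<^sub>R u n))"
      by (rule d_le)
    then have "d\<^sup>2 \<le> (norm (a - ((1/2) *\<^sub>R u m + (1/2) *\<^sub>R u n)))\<^sup>2"
      using d0 by (intro power_mono) auto
    moreover have "(norm (u m - u n))\<^sup>2 + 4 * (norm (a - ((1/2) *\<^sub>R u m + (1/2) *\<^sub>R u n)))\<^sup>2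
        = 2 * (norm (a - u m))\<^sup>2 + 2 * (norm (a - u n))\<^sup>2"
      unfolding power2_norm_eq_inner
      by (simp add: inner_diff_left inner_diff_right inner_add_left inner_add_right
          inner_commute algebra_simps)
    ultimately show ?thesis by linarith
  qed
  have "Cauchy u"
  proof (rule metric_CauchyI)
    fix e :: real assume e: "e > 0"
    have "(\<lambda>n. (norm (a - u n))\<^sup>2) \<longlonglongrightarrow> d\<^sup>2"
      using norm_lim by (intro tendsto_intros)
    then have "\<forall>\<^sub>F n in sequentially. (norm (a - u n))\<^sup>2 < d\<^sup>2 + e\<^sup>2 / 4"
      by (rule order_tendstoD(2)) (use e in simp)
    then obtain N where N: "\<And>n. n \<ge> N \<Longrightarrow> (norm (a - u n))\<^sup>2 < d\<^sup>2 + e\<^sup>2 / 4"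
      by (auto simp: eventually_sequentially)
    show "\<exists>N. \<forall>m\<ge>N. \<forall>n\<ge>N. dist (u m) (u n) < e"
    proof (intro exI allI impI)
      fix m n assume "m \<ge> N" "n \<ge> N"
      then have "(norm (u m - u n))\<^sup>2 < e\<^sup>2"
        using para[of m n] N[of m] N[of n] by linarith
      then show "dist (u m) (u n) < e"
        using e by (simp add: dist_norm power2_less_imp_less)
    qed
  qed
  then obtain p where p: "u \<longlonglongrightarrow> p"
    using Cauchy_convergent convergent_def by blast
  have "p \<in> C"
    using assms(1) u(1) p closed_sequentially by blast
  moreover have "norm (a - p) = d"
    by (rule LIMSEQ_unique[OF _ norm_lim]) (intro tendsto_intros p)
  ultimately show thesis
    using that d_le by metis
qed

text \<open>The closest point works: a nonzero inner product with some \<open>y\<close> in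
  \<open>M\<close> would allow a move along \<open>y\<close> that comes closer to
  \<open>a\<close>.\<close>

lemma orthogonal_projection_exists:
  fixes M :: "'a::{real_inner,banach} set"
  assumes "closed M" "subspace M"
  obtains p where "p \<in> M" "\<And>y. y \<in> M \<Longrightarrow> inner (a - p) y = 0"
proof -
  have "M \<noteq> {}" using assms(2) subspace_0 by blast
  then obtain p where p: "p \<in> M" "\<And>y. y \<in> M \<Longrightarrow> norm (a - p) \<le> norm (a - y)"
    using closest_point_exists[of M a] assms subspace_imp_convex by metis
  have "inner (a - p) y = 0" if y: "y \<in> M" for y
  proof (cases "y = 0")
    case False
    \<comment> \<open>This \<open>t\<close> minimizes the distance from \<open>a\<close> to
      \<open>p + t *\<^sub>R y\<close>.\<close>
    define t where "t = inner (a - p) y / (norm y)\<^sup>2"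
    have "p + t *\<^sub>R y \<in> M"
      using assms(2) p(1) y by (simp add: subspace_add subspace_scale)
    then have "(norm (a - p))\<^sup>2 \<le> (norm (a - (p + t *\<^sub>R y)))\<^sup>2"
      using p(2) by (intro power_mono) auto
    also have "\<dots> = (norm (a - p))\<^sup>2 - 2 * t * inner (a - p) y + t\<^sup>2 * (norm y)\<^sup>2"
      unfolding power2_norm_eq_inner
      by (simp add: inner_diff_left inner_diff_right inner_add_left inner_add_right
          inner_commute algebra_simps power2_eq_square)
    also have "t\<^sup>2 * (norm y)\<^sup>2 = t * inner (a - p) y"
      using False by (simp add: t_def power2_eq_square)
    finally have "t * inner (a - p) y \<le> 0" by simp
    then have "(inner (a - p) y)\<^sup>2 / (norm y)\<^sup>2 \<le> 0"
      by (simp add: t_def power2_eq_square)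
    then have "(inner (a - p) y)\<^sup>2 \<le> 0"
      using False by (simp add: divide_le_0_iff)
    then show ?thesis by simp
  qed simp
  then show thesis using that p(1) by blast
qed

text \<open>The kernel of \<open>f\<close> is a closed hyperplane, so a suitable multiple of a
  normal vector \<open>w\<close> represents \<open>f\<close>: subtracting
  \<open>(f x / f w) *\<^sub>R w\<close> from \<open>x\<close> lands in the kernel.\<close>

lemma riesz_representation:
  fixes f :: "'a::{real_inner,banach} \<Rightarrow> real"
  assumes f: "bounded_linear f"
  obtains z where "\<And>x. f x = inner x z"
proof (cases "\<forall>x. f x = 0")
  case True
  then show thesis using that[of 0] by simp
next
  case False
  then obtain a where a: "f a \<noteq> 0" by blast
  interpret bounded_linear f by (rule f)
  have "closed {x. f x = 0}"
    by (intro closed_Collect_eq continuous_intros continuous_on)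
  moreover have "subspace {x. f x = 0}"
    by (auto simp: subspace_def zero add scale)
  ultimately obtain p where p: "f p = 0" "\<And>y. f y = 0 \<Longrightarrow> inner (a - p) y = 0"
    using orthogonal_projection_exists[of "{x. f x = 0}" a] by auto
  define w where "w = a - p"
  have fw: "f w \<noteq> 0" using a p(1) by (simp add: w_def diff)
  then have w: "w \<noteq> 0" using zero by auto
  have "f x = inner x ((f w / (norm w)\<^sup>2) *\<^sub>R w)" for x
  proof -
    have "f (x - (f x / f w) *\<^sub>R w) = 0" using fw by (simp add: diff scale)
    then have "inner w (x - (f x / f w) *\<^sub>R w) = 0" using p(2) w_def by blast
    then have "inner x w = (f x / f w) * (norm w)\<^sup>2"
      by (simp add: inner_diff_right inner_commute power2_norm_eq_inner)
    then show ?thesis using w fw by simp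
  qed
  then show thesis using that by blast
qed

text \<open>Solving \<open>G x = y\<close> means finding a fixed point of the map from
  \<open>x\<close> to \<open>x - t *\<^sub>R (G x - y)\<close>, which coercivity makes a contraction
  for small positive \<open>t\<close>.\<close>

lemma coercive_surj:
  fixes G :: "'a::{real_inner,banach} \<Rightarrow> 'a"
  assumes G: "bounded_linear G" and coercive: "\<And>x. (norm x)\<^sup>2 \<le> inner (G x) x"
  shows "surj G"
proof -
  interpret bounded_linear G by (rule G)
  obtain C where C: "C > 0" "\<And>x. norm (G x) \<le> norm x * C"
    using pos_bounded by blast
  \<comment> \<open>Raising the bound to at least 1 ensures \<open>t \<le> 1\<close> below, so that
    the contraction factor \<open>sqrt (1 - t)\<close> is real.\<close>
  define D where "D = max C 1"
  have D: "D \<ge> 1" "\<And>x. norm (G x) \<le> D * norm x"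
    by (simp add: D_def)
      (metis C(2) D_def max.cobounded1 mult.commute mult_left_mono norm_ge_zero order_trans)
  \<comment> \<open>The minimizer of \<open>1 - 2 * t + t^2 * D^2\<close>, the estimate for the
    squared contraction factor.\<close>
  define t where "t = 1 / D\<^sup>2"
  have D2: "D\<^sup>2 \<ge> 1" using D(1) by (simp add: one_le_power)
  have t: "t > 0" "t \<le> 1" "t\<^sup>2 * D\<^sup>2 = t"
    using D2 by (auto simp: t_def power2_eq_square)
  have contr: "norm (x - t *\<^sub>R G x) \<le> sqrt (1 - t) * norm x" for x
  proof -
    have "(norm (x - t *\<^sub>R G x))\<^sup>2 = (norm x)\<^sup>2 - 2 * t * inner (G x) x + t\<^sup>2 * (norm (G x))\<^sup>2"
      unfolding power2_norm_eq_inner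
      by (simp add: inner_diff_left inner_diff_right inner_commute algebra_simps power2_eq_square)
    also have "\<dots> \<le> (norm x)\<^sup>2 - 2 * t * (norm x)\<^sup>2 + t\<^sup>2 * (D * norm x)\<^sup>2"
      using t coercive[of x] D(2)[of x]
      by (intro add_mono diff_mono mult_left_mono power_mono) auto
    also have "t\<^sup>2 * (D * norm x)\<^sup>2 = t * (norm x)\<^sup>2"
      by (simp add: power_mult_distrib t(3) flip: mult.assoc)
    also have "(norm x)\<^sup>2 - 2 * t * (norm x)\<^sup>2 + t * (norm x)\<^sup>2 = (sqrt (1 - t) * norm x)\<^sup>2"
      using t(2) by (simp add: power_mult_distrib algebra_simps)
    finally show ?thesis
      by (rule power2_le_imp_le) (use t(2) in simp)
  qed
  have "\<exists>x. G x = y" for y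
  proof -
    have "\<exists>!x. x - t *\<^sub>R (G x - y) = x"
    proof (rule banach_fix_type)
      show "0 \<le> sqrt (1 - t)" "sqrt (1 - t) < 1" using t by auto
      show "\<forall>x z. dist (x - t *\<^sub>R (G x - y)) (z - t *\<^sub>R (G z - y)) \<le> sqrt (1 - t) * dist x z"
      proof (intro allI)
        fix x z
        show "dist (x - t *\<^sub>R (G x - y)) (z - t *\<^sub>R (G z - y)) \<le> sqrt (1 - t) * dist x z"
          using contr[of "x - z"] by (simp add: dist_norm diff algebra_simps)
      qed
    qed
    then show ?thesis using t(1) by auto
  qed
  then show ?thesis by (metis surj_def)
qed

section \<open>Absolute values and hyperinvariant subspaces of symmetric operators\<close>

text \<open>The solution is \<open>Y = 1 - (1 - K)\<^sup>1\<^sup>/\<^sup>2\<close>. The scalar iteration with \<open>K = 1\<close> converges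
  monotonically and majorizes the increments of the operator iteration.\<close>

lemma blinfun_quadratic_solution:
  fixes K :: "'a::banach \<Rightarrow>\<^sub>L 'a"
  assumes "norm K \<le> 1"
  obtains Y where "norm Y \<le> 1" "2 *\<^sub>R Y = K + (Y o\<^sub>L Y)"
    "\<And>S. S o\<^sub>L K = K o\<^sub>L S \<Longrightarrow> S o\<^sub>L Y = Y o\<^sub>L S"
proof -
  define Y where "Y = rec_nat 0 (\<lambda>_ Z. (1/2) *\<^sub>R (K + (Z o\<^sub>L Z)))"
  define y :: "nat \<Rightarrow> real" where "y = rec_nat 0 (\<lambda>_ z. (1/2) * (1 + z * z))"
  have Y_rec: "Y 0 = 0" "\<And>n. Y (Suc n) = (1/2) *\<^sub>R (K + (Y n o\<^sub>L Y n))"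
    by (simp_all add: Y_def)
  have y_rec: "y 0 = 0" "\<And>n. y (Suc n) = (1/2) * (1 + y n * y n)"
    by (simp_all add: y_def)
  have y_bounds: "0 \<le> y n \<and> y n \<le> 1" for n
  proof (induction n)
    case (Suc n)
    then have "y n * y n \<le> 1 * 1" by (intro mult_mono) auto
    then show ?case by (simp add: y_rec)
  qed (simp add: y_rec)
  have Y_le: "norm (Y n) \<le> y n" for n
  proof (induction n)
    case (Suc n)
    have "norm (Y n o\<^sub>L Y n) \<le> y n * y n"
      using norm_blinfun_compose[of "Y n" "Y n"] mult_mono[OF Suc Suc] y_bounds[of n] by simp
    then have "norm (K + (Y n o\<^sub>L Y n)) \<le> 1 + y n * y n"
      using assms norm_triangle_ineq[of K "Y n o\<^sub>L Y n"] by linarith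
    then show ?case by (simp add: Y_rec y_rec)
  qed (simp add: Y_rec y_rec)
  have step: "norm (Y (Suc n) - Y n) \<le> y (Suc n) - y n" for n
  proof (induction n)
    case 0
    then show ?case using assms by (simp add: Y_rec y_rec)
  next
    case (Suc n)
    let ?E = "Y (Suc n) - Y n" and ?e = "y (Suc n) - y n"
    \<comment> \<open>The difference of the squares of \<open>Y (Suc n)\<close> and
      \<open>Y n\<close> is split by inserting \<open>Y (Suc n) o\<^sub>L Y n\<close>, which avoids
      commuting the two iterates.\<close>
    have "Y (Suc (Suc n)) - Y (Suc n) = (1/2) *\<^sub>R ((Y (Suc n) o\<^sub>L ?E) + (?E o\<^sub>L Y n))"
      unfolding Y_rec(2)[of "Suc n"] Y_rec(2)[of n]
      by (intro blinfun_eqI)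
        (simp add: blinfun.add_left blinfun.diff_left blinfun.diff_right blinfun.add_right
          blinfun.scaleR_left blinfun.scaleR_right algebra_simps)
    moreover have "norm (Y (Suc n) o\<^sub>L ?E) \<le> y (Suc n) * ?e"
      using y_bounds[of "Suc n"]
      by (intro order_trans[OF norm_blinfun_compose] mult_mono Y_le Suc) auto
    moreover have "norm (?E o\<^sub>L Y n) \<le> ?e * y n"
      using order_trans[OF norm_ge_zero Suc] by (intro order_trans[OF norm_blinfun_compose] mult_mono Y_le Suc) auto
    ultimately have "norm (Y (Suc (Suc n)) - Y (Suc n)) \<le> (1/2) * (y (Suc n) * ?e + ?e * y n)"
      using norm_triangle_ineq[of "Y (Suc n) o\<^sub>L ?E" "?E o\<^sub>L Y n"] by simp
    also have "\<dots> = y (Suc (Suc n)) - y (Suc n)"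
      unfolding y_rec(2)[of "Suc n"] using y_rec(2)[of n] by algebra
    finally show ?case .
  qed
  have "incseq y"
    using order_trans[OF norm_ge_zero step] by (intro incseq_SucI) simp
  moreover have "bdd_above (range y)"
    using y_bounds by (intro bdd_aboveI[of _ 1]) auto
  ultimately have "convergent y"
    using incseq_convergent[of y 1] y_bounds by (metis convergent_def)
  then have "summable (\<lambda>n. y (Suc n) - y n)"
    by (metis convergent_LIMSEQ_iff telescope_summable)
  then have "summable (\<lambda>n. Y (Suc n) - Y n)"
    using step by (rule summable_comparison_test')
  then obtain L where "(\<lambda>n. \<Sum>i<n. Y (Suc i) - Y i) \<longlonglongrightarrow> L"
    by (auto simp: summable_def sums_def)
  then have L: "Y \<longlonglongrightarrow> L"
    by (simp add: sum_lessThan_telescope Y_rec(1))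
  have "norm L \<le> 1"
    by (rule tendsto_upperbound[OF tendsto_norm[OF L]])
      (use Y_le y_bounds order_trans in \<open>auto intro!: always_eventually, blast\<close>)
  moreover have "2 *\<^sub>R L = K + (L o\<^sub>L L)"
  proof -
    have "(\<lambda>n. (1/2) *\<^sub>R (K + (Y n o\<^sub>L Y n))) \<longlonglongrightarrow> (1/2) *\<^sub>R (K + (L o\<^sub>L L))"
      by (intro tendsto_intros bounded_bilinear.tendsto[OF bounded_bilinear_blinfun_compose] L)
    moreover have "(\<lambda>n. (1/2) *\<^sub>R (K + (Y n o\<^sub>L Y n))) \<longlonglongrightarrow> L"
      using LIMSEQ_Suc[OF L] by (simp add: Y_rec)
    ultimately have "L = (1/2) *\<^sub>R (K + (L o\<^sub>L L))"
      using LIMSEQ_unique by blast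
    then have "2 *\<^sub>R L = 2 *\<^sub>R ((1/2) *\<^sub>R (K + (L o\<^sub>L L)))"
      by simp
    then show ?thesis by simp
  qed
  moreover have "S o\<^sub>L L = L o\<^sub>L S" if S: "S o\<^sub>L K = K o\<^sub>L S" for S
  proof -
    have "S o\<^sub>L Y n = Y n o\<^sub>L S" for n
    proof (induction n)
      case 0
      show ?case by (intro blinfun_eqI) (simp add: Y_rec)
    next
      case (Suc n)
      have "S (K x) = K (S x)" "S (Y n x) = Y n (S x)" for x
        using S Suc by (metis blinfun_apply_blinfun_compose)+
      then show ?case
        by (intro blinfun_eqI)
          (simp add: Y_rec blinfun.add_left blinfun.add_right blinfun.scaleR_left blinfun.scaleR_right)
    qed
    moreover have "(\<lambda>n. S o\<^sub>L Y n) \<longlonglongrightarrow> (S o\<^sub>L L)" "(\<lambda>n. Y n o\<^sub>L S) \<longlonglongrightarrow> (L o\<^sub>L S)"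
      by (intro bounded_bilinear.tendsto[OF bounded_bilinear_blinfun_compose] tendsto_const L)+
    ultimately show ?thesis
      using LIMSEQ_unique by fastforce
  qed
  ultimately show thesis using that by blast
qed

text \<open>\<open>S\<close> is the square root of \<open>A o\<^sub>L A\<close>. Substituting
  \<open>S = 1 - Y\<close> turns \<open>S^2 = A^2\<close> into \<open>2 Y = K + Y^2\<close> with
  \<open>K = 1 - A^2\<close>, and \<open>norm K \<le> 1\<close> because \<open>A\<close> is a
  symmetric contraction. The second property is the only consequence of positivity of
  \<open>S\<close> that is used later.\<close>

lemma symmetric_abs:
  fixes A :: "'a::{real_inner,banach} \<Rightarrow>\<^sub>L 'a"
  assumes "norm A \<le> 1" and sym: "\<And>x y. inner (A x) y = inner x (A y)"
  obtains S where "S o\<^sub>L S = A o\<^sub>L A" "\<And>e. inner (S e) e = 0 \<Longrightarrow> S e = 0"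
    "\<And>B. B o\<^sub>L A = A o\<^sub>L B \<Longrightarrow> B o\<^sub>L S = S o\<^sub>L B"
proof -
  define K where "K = id_blinfun - (A o\<^sub>L A)"
  have K_x: "K x = x - A (A x)" for x
    by (simp add: K_def blinfun.diff_left)
  have "norm (K x) \<le> norm x" for x
  proof -
    have "norm (A (A x)) \<le> norm (A x)"
      using norm_blinfun[of A "A x"] assms(1) mult_right_mono[OF assms(1) norm_ge_zero, of "A x"]
      by simp
    then have "inner (A (A x)) (A (A x)) \<le> inner (A x) (A x)"
      by (simp flip: power2_norm_eq_inner)
    moreover have "(norm (K x))\<^sup>2 = (norm x)\<^sup>2 - 2 * inner (A x) (A x) + inner (A (A x)) (A (A x))"
      using sym[of x "A x"] inner_commute[of x "A (A x)"]
      by (simp add: K_x power2_norm_eq_inner inner_diff_left inner_diff_right)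
    moreover have "inner (A x) (A x) \<ge> 0" by simp
    ultimately have "(norm (K x))\<^sup>2 \<le> (norm x)\<^sup>2" by linarith
    then show ?thesis by (rule power2_le_imp_le) simp
  qed
  then have "norm K \<le> 1" by (intro norm_blinfun_bound) auto
  then obtain Y where Y: "norm Y \<le> 1" "2 *\<^sub>R Y = K + (Y o\<^sub>L Y)"
    "\<And>S. S o\<^sub>L K = K o\<^sub>L S \<Longrightarrow> S o\<^sub>L Y = Y o\<^sub>L S"
    using blinfun_quadratic_solution by blast
  define S where "S = id_blinfun - Y"
  have "S o\<^sub>L S = A o\<^sub>L A"
  proof (rule blinfun_eqI)
    fix x
    have "2 *\<^sub>R Y x = x - A (A x) + Y (Y x)"
      using arg_cong[OF Y(2), of "\<lambda>Z. Z x"]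
      by (simp add: K_def blinfun.scaleR_left blinfun.add_left blinfun.diff_left)
    then show "(S o\<^sub>L S) x = (A o\<^sub>L A) x"
      by (simp add: S_def blinfun.diff_left blinfun.diff_right scaleR_2 algebra_simps)
  qed
  \<comment> \<open>Here \<open>norm Y \<le> 1\<close> stands in for positivity of \<open>S\<close>:
    if \<open>inner (Y e) e = inner e e\<close>, expanding the square gives
    \<open>norm (e - Y e) = 0\<close>.\<close>
  moreover have "S e = 0" if "inner (S e) e = 0" for e
  proof -
    have "norm (Y e) \<le> norm e"
      using norm_blinfun[of Y e] mult_right_mono[OF Y(1) norm_ge_zero, of e] by simp
    then have "inner (Y e) (Y e) \<le> inner e e"
      by (simp flip: power2_norm_eq_inner)
    moreover have "inner (Y e) e = inner e e"
      using that by (simp add: S_def blinfun.diff_left inner_diff_left)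
    ultimately have "inner (e - Y e) (e - Y e) \<le> 0"
      by (simp add: inner_diff_left inner_diff_right inner_commute)
    then have "e - Y e = 0"
      by (metis inner_ge_zero inner_eq_zero_iff order_antisym)
    then show ?thesis
      by (simp add: S_def blinfun.diff_left)
  qed
  moreover have "B o\<^sub>L S = S o\<^sub>L B" if B: "B o\<^sub>L A = A o\<^sub>L B" for B
  proof -
    have BA: "B (A x) = A (B x)" for x
      using B by (metis blinfun_apply_blinfun_compose)
    have "B o\<^sub>L Y = Y o\<^sub>L B"
      by (rule Y(3), rule blinfun_eqI) (simp add: K_def blinfun.diff_left blinfun.diff_right BA)
    then have "B (Y x) = Y (B x)" for x
      by (metis blinfun_apply_blinfun_compose)
    then show ?thesis
      by (intro blinfun_eqI) (simp add: S_def blinfun.diff_left blinfun.diff_right)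
  qed
  ultimately show thesis using that by blast
qed

text \<open>With \<open>V = c(A - t)\<close> and \<open>S = |V|\<close> one has \<open>(S - V)(S + V) = 0\<close>, so the kernel of \<open>S - V\<close> is
  nontrivial unless \<open>V = \<plusminus>S\<close>; choosing \<open>t = \<langle>Ae, e\<rangle> / \<langle>e, e\<rangle>\<close> then puts \<open>e\<close> into the kernel of \<open>V\<close>.\<close>

lemma symmetric_hyperinvariant_subspace:
  fixes A :: "'a::{real_inner,banach} \<Rightarrow> 'a"
  assumes A: "bounded_linear A" and sym: "\<And>x y. inner (A x) y = inner x (A y)"
    and nonscalar: "\<And>t. A \<noteq> (\<lambda>x. t *\<^sub>R x)"
  obtains M where "closed M" "subspace M" "M \<noteq> {0}" "M \<noteq> UNIV"
    "\<And>B. bounded_linear B \<Longrightarrow> (\<And>x. B (A x) = A (B x)) \<Longrightarrow> B ` M \<subseteq> M"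
proof -
  interpret bounded_linear A by (rule A)
  have "\<exists>e. A e \<noteq> 0 *\<^sub>R e" using nonscalar[of 0] by blast
  then obtain e :: 'a where e: "e \<noteq> 0" using zero by force
  define t where "t = inner (A e) e / inner e e"
  define N where "N = Blinfun (\<lambda>x. A x - t *\<^sub>R x)"
  have N: "N x = A x - t *\<^sub>R x" for x
    unfolding N_def
    by (subst bounded_linear_Blinfun_apply)
      (auto intro!: bounded_linear_sub A bounded_linear_scaleR_right)
  \<comment> \<open>Scales \<open>N\<close> to a contraction, as \<open>symmetric_abs\<close>
    requires; the summand 1 keeps the denominator positive.\<close>
  define c where "c = 1 / (norm N + 1)"
  have c: "c > 0" "c * norm N \<le> 1"
    using norm_ge_zero[of N] by (auto simp: c_def add_nonneg_pos divide_le_eq)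
  define V where "V = c *\<^sub>R N"
  have V: "V x = c *\<^sub>R (A x - t *\<^sub>R x)" for x
    by (simp add: V_def N blinfun.scaleR_left)
  have "norm V \<le> 1" using c by (simp add: V_def)
  moreover have "inner (V x) y = inner x (V y)" for x y
    by (simp add: V inner_diff_left inner_diff_right sym)
  ultimately obtain S where S: "S o\<^sub>L S = V o\<^sub>L V" "\<And>e. inner (S e) e = 0 \<Longrightarrow> S e = 0"
    "\<And>B. B o\<^sub>L V = V o\<^sub>L B \<Longrightarrow> B o\<^sub>L S = S o\<^sub>L B"
    using symmetric_abs by blast
  have SV: "S (V x) = V (S x)" for x
    using S(3)[of V] by (metis blinfun_apply_blinfun_compose)
  have SS: "S (S x) = V (V x)" for x
    using S(1) by (metis blinfun_apply_blinfun_compose)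
  have comm: "B (V x) = V (B x) \<and> B (S x) = S (B x)"
    if B: "bounded_linear B" "\<And>x. B (A x) = A (B x)" for B x
  proof -
    interpret B: bounded_linear B by (rule B(1))
    have app: "Blinfun B x = B x" for x by (simp add: bounded_linear_Blinfun_apply B)
    have BV: "B (V x) = V (B x)" for x by (simp add: V B.scale B.diff B(2))
    have "Blinfun B o\<^sub>L S = S o\<^sub>L Blinfun B"
      by (rule S(3), rule blinfun_eqI) (simp add: app BV)
    then show ?thesis using BV by (metis blinfun_apply_blinfun_compose app)
  qed
  have ker: "closed {x. L x = 0}" "subspace {x. L x = 0}" for L :: "'a \<Rightarrow>\<^sub>L 'a"
    by (auto intro!: closed_Collect_eq continuous_intros
        simp: subspace_def blinfun.add_right blinfun.scaleR_right)
  show thesis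
  proof (cases "{x. (S - V) x = 0} = {0} \<or> {x. (S - V) x = 0} = UNIV")
    case False
    show thesis
    proof (rule that[OF ker[of "S - V"]])
      fix B assume "bounded_linear B" "\<And>x. B (A x) = A (B x)"
      then show "B ` {x. (S - V) x = 0} \<subseteq> {x. (S - V) x = 0}"
        using comm[of B] by (auto simp: blinfun.diff_left) metis
    qed (use False in auto)
  next
    case True
    have "V e = S e \<or> V e = - S e"
    proof (rule disjE[OF True])
      assume *: "{x. (S - V) x = 0} = {0}"
      have "(S - V) (S e + V e) = 0"
        by (simp add: blinfun.diff_left blinfun.add_right SV SS)
      then have "S e + V e = 0" using * by blast
      then show ?thesis by (simp add: eq_neg_iff_add_eq_0 add.commute)
    next
      assume "{x. (S - V) x = 0} = UNIV"
      then have "(S - V) e = 0" by blast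
      then show ?thesis by (simp add: blinfun.diff_left)
    qed
    \<comment> \<open>This is the purpose of \<open>t\<close>. Since
      \<open>V e = \<plusminus> S e\<close>, also \<open>inner (S e) e = 0\<close>, which forces
      \<open>S e = 0\<close> and so \<open>V e = 0\<close>.\<close>
    moreover have "inner (V e) e = 0"
      using e by (simp add: V inner_diff_left t_def)
    ultimately have Ve: "V e = 0" using S(2)[of e] by auto
    show thesis
    proof (rule that[OF ker[of V]])
      show "{x. V x = 0} \<noteq> {0}" using Ve e by blast
      show "{x. V x = 0} \<noteq> UNIV"
      proof
        assume "{x. V x = 0} = UNIV"
        then have "A = (\<lambda>x. t *\<^sub>R x)" using c(1) by (auto simp: V set_eq_iff)
        then show False using nonscalar by blast
      qed
      fix B assume B: "bounded_linear B" "\<And>x. B (A x) = A (B x)"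
      interpret B: bounded_linear B by (rule B(1))
      show "B ` {x. V x = 0} \<subseteq> {x. V x = 0}"
      proof clarify
        fix x assume "V x = 0"
        then show "V (B x) = 0" using comm[OF B, of x] B.zero by metis
      qed
    qed
  qed
qed

section \<open>Operators on complex Hilbert spaces\<close>

text \<open>The imaginary part of \<open>cinner x y\<close> is minus the real part of
  \<open>cinner (\<i> *\<^sub>C x) y\<close>, so identities for \<open>cinner\<close> reduce to the
  real results above.\<close>

lemma cinner_eq_iff: "cinner x y = cinner u v \<longleftrightarrow>
    inner x y = inner u v \<and> inner (\<i> *\<^sub>C x) y = inner (\<i> *\<^sub>C u) v"
  by (auto simp: complex_eq_iff inner_eq_Re_cinner cinner_scaleC_left)

lemma norm_scaleC: "norm (c *\<^sub>C x) = cmod c * norm x" for x :: "'a::complex_inner"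
proof -
  have "cinner (c *\<^sub>C x) (c *\<^sub>C x) = c * cnj c * cinner x x"
    by (metis cinner_commute cinner_scaleC_left complex_cnj_mult mult.assoc)
  then have "(norm (c *\<^sub>C x))\<^sup>2 = (cmod c * norm x)\<^sup>2"
    unfolding cinner_self complex_norm_square[symmetric] power_mult_distrib
    by (metis of_real_eq_iff of_real_mult)
  then show ?thesis
    by (simp add: power2_eq_iff_nonneg)
qed

lemma bounded_linear_scaleC: "bounded_linear (\<lambda>x::'a::complex_inner. c *\<^sub>C x)"
proof (rule bounded_linear_intro)
  show "c *\<^sub>C r *\<^sub>R x = r *\<^sub>R c *\<^sub>C x" for r and x :: 'a
    by (simp add: scaleR_scaleC scaleC_scaleC mult.commute)
  show "norm (c *\<^sub>C x) \<le> norm x * cmod c" for x :: 'a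
    by (simp add: norm_scaleC)
qed (rule scaleC_add_right)

lemma bounded_clinear_iff:
  "bounded_clinear T \<longleftrightarrow> bounded_linear T \<and> (\<forall>c x. T (c *\<^sub>C x) = c *\<^sub>C T x)"
proof
  assume "bounded_clinear T"
  then show "bounded_linear T \<and> (\<forall>c x. T (c *\<^sub>C x) = c *\<^sub>C T x)"
    unfolding bounded_clinear_def Vector_Spaces.linear_def module_hom_def module_hom_axioms_def
    by blast
next
  assume *: "bounded_linear T \<and> (\<forall>c x. T (c *\<^sub>C x) = c *\<^sub>C T x)"
  then have "Vector_Spaces.linear scaleC scaleC T"
    by unfold_locales (auto dest: bounded_linear.linear linear_add)
  then show "bounded_clinear T"
    using * by (simp add: bounded_clinear_def)
qed

lemma bounded_clinearD:
  assumes "bounded_clinear T"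
  shows "bounded_linear T" "T (x + y) = T x + T y" "T (x - y) = T x - T y"
    "T (c *\<^sub>C x) = c *\<^sub>C T x" "T (r *\<^sub>R x) = r *\<^sub>R T x" "T 0 = 0"
proof -
  show T: "bounded_linear T" using assms by (simp add: bounded_clinear_iff)
  interpret bounded_linear T by (rule T)
  show "T (x + y) = T x + T y" "T (x - y) = T x - T y" "T (r *\<^sub>R x) = r *\<^sub>R T x" "T 0 = 0"
    by (simp_all add: add diff scale zero)
  show "T (c *\<^sub>C x) = c *\<^sub>C T x"
    using assms by (simp add: bounded_clinear_iff)
qed

lemma inner_scaleC_left: "inner (c *\<^sub>C x) y = inner x (cnj c *\<^sub>C y)"
  by (metis cinner_commute cinner_scaleC_left complex_cnj_cnj complex_cnj_mult inner_eq_Re_cinner)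

section \<open>The adjoint and self-adjointness\<close>

lemma cinner_right_eqD:
  fixes y z :: "'a::complex_inner"
  assumes "\<And>x. cinner x y = cinner x z"
  shows "y = z"
proof -
  have "inner x y = inner x z" for x
    using assms by (simp add: inner_eq_Re_cinner)
  then show ?thesis
    by (metis inner_commute vector_eq_rdot)
qed

lemma cadjoint_eqI:
  assumes "\<And>x y. cinner (T x) y = cinner x (S y)"
  shows "cadjoint T = S"
  unfolding cadjoint_def
proof (rule the_equality)
  fix R assume R: "\<forall>x y. cinner (T x) y = cinner x (R y)"
  show "R = S"
  proof
    fix y show "R y = S y"
      by (rule cinner_right_eqD) (use R assms in metis)
  qed
qed (use assms in blast)

text \<open>Justifies the definite description in \<open>cadjoint\<close>: the real Riesz
  representation gives a real adjoint, and complex linearity of \<open>T\<close> makes it an adjoint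
  for \<open>cinner\<close>.\<close>

lemma cinner_cadjoint:
  assumes T: "bounded_clinear T"
  shows "cinner (T x) y = cinner x (cadjoint T y)"
proof -
  have bl: "bounded_linear T" and scale: "T (c *\<^sub>C x) = c *\<^sub>C T x" for c x
    using T by (auto simp: bounded_clinear_iff)
  have "\<exists>z. \<forall>x. inner (T x) y = inner x z" for y
    using riesz_representation[OF bounded_linear_compose[OF bounded_linear_inner_left bl], of y]
    by metis
  then obtain S where S: "\<And>x y. inner (T x) y = inner x (S y)"
    by metis
  have "cinner (T x) y = cinner x (S y)" for x y
    unfolding cinner_eq_iff using S by (simp flip: scale)
  then show ?thesis
    using cadjoint_eqI[of T S] by simp
qed

lemma inner_cadjoint:
  assumes "bounded_clinear T"
  shows "inner (T x) y = inner x (cadjoint T y)"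
  using cinner_cadjoint[OF assms] by (simp add: inner_eq_Re_cinner)

text \<open>Linearity follows by testing against all \<open>x\<close>; boundedness, with the
  constant of \<open>T\<close>, follows by cancelling \<open>norm ?y\<close> in an estimate of
  \<open>norm ?y * norm ?y = inner (T ?y) x\<close>.\<close>

lemma bounded_clinear_cadjoint:
  assumes T: "bounded_clinear T"
  shows "bounded_clinear (cadjoint T)"
proof -
  interpret bounded_linear T
    using T by (simp add: bounded_clinear_iff)
  note adj = cinner_cadjoint[OF T, symmetric]
  have add_right: "cinner x (y + z) = cinner x y + cinner x z" for x y z :: 'a
    by (metis cinner_add_left cinner_commute complex_cnj_add)
  have scale_right: "cinner x (c *\<^sub>C z) = cnj c * cinner x z" for c and x z :: 'a
    by (metis cinner_scaleC_left cinner_commute complex_cnj_mult)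
  have scale: "cadjoint T (c *\<^sub>C x) = c *\<^sub>C cadjoint T x" for c x
    by (rule cinner_right_eqD) (simp add: adj scale_right)
  obtain C where C: "C > 0" "\<And>x. norm (T x) \<le> norm x * C"
    using pos_bounded by blast
  have "bounded_linear (cadjoint T)"
  proof (rule bounded_linear_intro)
    show "cadjoint T (x + y) = cadjoint T x + cadjoint T y" for x y
      by (rule cinner_right_eqD) (simp add: adj add_right)
    show "cadjoint T (r *\<^sub>R x) = r *\<^sub>R cadjoint T x" for r x
      by (simp add: scaleR_scaleC scale)
    fix x
    let ?y = "cadjoint T x"
    have "norm ?y * norm ?y = inner (T ?y) x"
      by (simp add: inner_cadjoint[OF T] flip: power2_norm_eq_inner power2_eq_square)
    also have "\<dots> \<le> norm (T ?y) * norm x"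
      by (rule norm_cauchy_schwarz)
    also have "\<dots> \<le> (norm ?y * C) * norm x"
      using C(2) by (rule mult_right_mono) simp
    finally have "norm ?y * norm ?y \<le> norm ?y * (norm x * C)"
      by (simp add: mult_ac)
    then show "norm ?y \<le> norm x * C"
      using C(1) by (cases "?y = 0") auto
  qed
  then show ?thesis
    using scale by (simp add: bounded_clinear_iff)
qed

lemma self_adjoint_iff:
  "self_adjoint A \<longleftrightarrow> bounded_clinear A \<and> (\<forall>x y. inner (A x) y = inner x (A y))"
proof
  assume "self_adjoint A"
  then show "bounded_clinear A \<and> (\<forall>x y. inner (A x) y = inner x (A y))"
    using inner_cadjoint[of A] by (auto simp: self_adjoint_def)
next
  assume A: "bounded_clinear A \<and> (\<forall>x y. inner (A x) y = inner x (A y))"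
  have "cinner (A x) y = cinner x (A y)" for x y
    unfolding cinner_eq_iff using A by (metis bounded_clinear_iff)
  then show "self_adjoint A"
    using A cadjoint_eqI[of A A] by (simp add: self_adjoint_def)
qed

section \<open>Reducing subspaces from commuting self-adjoint operators\<close>

lemma complex_subspace_iff:
  fixes M :: "'a::complex_inner set"
  shows "complex_vector.subspace M \<longleftrightarrow> subspace M \<and> (\<forall>c. (*\<^sub>C) c ` M \<subseteq> M)"
proof -
  have "(\<forall>c. (*\<^sub>C) c ` M \<subseteq> M) \<longleftrightarrow> (\<forall>c. \<forall>x\<in>M. c *\<^sub>C x \<in> M)"
    by blast
  then show ?thesis
    by (auto simp: complex_vector.subspace_def subspace_def scaleR_scaleC)
qed

text \<open>The real hyperinvariant subspace of \<open>A\<close> is invariant under everything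
  commuting with \<open>A\<close>: under \<open>T\<close>, its adjoint, and multiplication by
  complex scalars.\<close>

lemma reducing_subspace_of_nonscalar:
  assumes T: "bounded_clinear T" and A: "self_adjoint A"
    and comm: "\<And>x. T (A x) = A (T x)" "\<And>x. cadjoint T (A x) = A (cadjoint T x)"
    and nonscalar: "\<And>t. A \<noteq> (\<lambda>x. t *\<^sub>R x)"
  shows "\<exists>M. reducing_subspace T M \<and> M \<noteq> {0} \<and> M \<noteq> UNIV"
proof -
  have A': "bounded_linear A" "\<And>x y. inner (A x) y = inner x (A y)"
      "\<And>c x. A (c *\<^sub>C x) = c *\<^sub>C A x"
    using A by (auto simp: self_adjoint_iff bounded_clinear_iff)
  obtain M where M: "closed M" "subspace M" "M \<noteq> {0}" "M \<noteq> UNIV"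
    "\<And>B. bounded_linear B \<Longrightarrow> (\<And>x. B (A x) = A (B x)) \<Longrightarrow> B ` M \<subseteq> M"
    using symmetric_hyperinvariant_subspace[OF A'(1,2) nonscalar] by blast
  have "T ` M \<subseteq> M" "cadjoint T ` M \<subseteq> M"
    using T bounded_clinear_cadjoint[OF T] comm M(5) by (auto simp: bounded_clinear_iff)
  moreover have "(*\<^sub>C) c ` M \<subseteq> M" for c
    by (rule M(5)) (simp_all add: bounded_linear_scaleC A'(3))
  ultimately show ?thesis
    using M(1-4) unfolding reducing_subspace_def complex_subspace_iff by blast
qed

text \<open>The orthogonal complement of a nonzero vector \<open>e\<close> is invariant under
  scalars; were it zero, \<open>e\<close> would span the whole space.\<close>

lemma reducing_subspace_of_scalar:
  assumes dim: "\<not> finite_cdim TYPE('a::chilbert_space)"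
    and T: "bounded_clinear (T :: 'a \<Rightarrow> 'a)" and eq: "\<And>x. T x = c *\<^sub>C x"
  shows "\<exists>M. reducing_subspace T M \<and> M \<noteq> {0} \<and> M \<noteq> UNIV"
proof -
  have "complex_vector.span {} \<noteq> (UNIV :: 'a set)"
    using dim unfolding finite_cdim_def by (metis finite.emptyI)
  then obtain e :: 'a where e: "e \<noteq> 0"
    by auto
  define M where "M = {x. cinner x e = 0}"
  have M_iff: "x \<in> M \<longleftrightarrow> inner x e = 0 \<and> inner (\<i> *\<^sub>C x) e = 0" for x
    by (auto simp: M_def complex_eq_iff inner_eq_Re_cinner cinner_scaleC_left)
  have "M = {x. inner x e = 0} \<inter> {x. inner (\<i> *\<^sub>C x) e = 0}"
    using M_iff by auto
  then have "closed M"
    using linear_continuous_on[OF bounded_linear_scaleC]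
    by (auto intro!: closed_Int closed_Collect_eq continuous_intros)
  moreover have "complex_vector.subspace M"
    using cinner_scaleC_left[of 0 0 e]
    by (auto simp: M_def complex_vector.subspace_def cinner_add_left cinner_scaleC_left)
  moreover have "T ` M \<subseteq> M"
    by (auto simp: M_def eq cinner_scaleC_left)
  moreover have "cadjoint T ` M \<subseteq> M"
  proof
    fix y assume "y \<in> cadjoint T ` M"
    then obtain x where x: "cinner x e = 0" "y = cadjoint T x"
      by (auto simp: M_def)
    have "cinner e x = 0"
      using x(1) cinner_commute[of e x] by simp
    then have "cinner e y = 0"
      using cinner_cadjoint[OF T, of e x] by (simp add: x(2) eq cinner_scaleC_left)
    then show "y \<in> M"
      using cinner_commute[of y e] by (simp add: M_def)
  qed
  moreover have "M \<noteq> UNIV"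
    using e by (auto simp: M_def set_eq_iff cinner_self intro!: exI[of _ e])
  moreover have "M \<noteq> {0}"
  proof
    assume M0: "M = {0}"
    have "x \<in> complex_vector.span {e}" for x
    proof -
      let ?a = "cinner x e / cinner e e"
      have "cinner (x + (- ?a) *\<^sub>C e) e = 0"
        using e unfolding cinner_add_left cinner_scaleC_left by (simp add: cinner_self)
      then have "x + (- ?a) *\<^sub>C e \<in> M"
        unfolding M_def by blast
      then have "x + (- ?a) *\<^sub>C e = 0"
        using M0 by blast
      then have "x = ?a *\<^sub>C e"
        by (simp only: complex_vector.scale_minus_left add_uminus_conv_diff right_minus_eq)
      then show ?thesis
        by (metis complex_vector.span_base complex_vector.span_scale singletonI)
    qed
    then have "complex_vector.span {e} = UNIV" by auto
    then show False
      using dim unfolding finite_cdim_def by (metis finite.emptyI finite.insertI)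
  qed
  ultimately show ?thesis
    unfolding reducing_subspace_def by blast
qed

lemma self_adjoint_scalar_of_irreducible:
  assumes "\<nexists>M. reducing_subspace T M \<and> M \<noteq> {0} \<and> M \<noteq> UNIV"
    and "bounded_clinear T" "self_adjoint A"
    and "\<And>x. T (A x) = A (T x)" "\<And>x. cadjoint T (A x) = A (cadjoint T x)"
  shows "\<exists>t. \<forall>x. A x = t *\<^sub>R x"
  using reducing_subspace_of_nonscalar[OF assms(2-5)] assms(1) by blast

lemma reducing_subspace_of_normal:
  fixes T :: "'a::chilbert_space \<Rightarrow> 'a"
  assumes dim: "\<not> finite_cdim TYPE('a)" and T: "bounded_clinear T"
    and normal: "\<And>x. cadjoint T (T x) = T (cadjoint T x)"
  shows "\<exists>M. reducing_subspace T M \<and> M \<noteq> {0} \<and> M \<noteq> UNIV"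
proof (rule ccontr)
  assume irreducible: "\<not> ?thesis"
  let ?T' = "cadjoint T"
  note T' = bounded_clinear_cadjoint[OF T]
  note lin = bounded_clinearD[OF T] bounded_clinearD[OF T']
  have adj: "inner (T x) y = inner x (?T' y)" "inner (?T' x) y = inner x (T y)" for x y
    using inner_cadjoint[OF T] by (auto simp: inner_commute)
  have "self_adjoint (\<lambda>x. T x + ?T' x)"
    unfolding self_adjoint_iff bounded_clinear_iff
    by (auto intro!: bounded_linear_add lin
        simp: lin scaleC_add_right inner_add_left inner_add_right adj)
  then have "\<exists>s. \<forall>x. T x + ?T' x = s *\<^sub>R x"
    by (rule self_adjoint_scalar_of_irreducible[OF irreducible T]) (simp_all add: lin normal)
  then obtain s where s: "\<And>x. T x + ?T' x = s *\<^sub>R x"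
    by blast
  have "self_adjoint (\<lambda>x. \<i> *\<^sub>C (T x - ?T' x))"
    unfolding self_adjoint_iff bounded_clinear_iff
    by (auto intro!: bounded_linear_compose[OF bounded_linear_scaleC] bounded_linear_sub lin
        simp: lin inner_diff_left inner_diff_right adj inner_scaleC_left scaleC_scaleC mult.commute
          complex_vector.scale_right_diff_distrib)
  then have "\<exists>t. \<forall>x. \<i> *\<^sub>C (T x - ?T' x) = t *\<^sub>R x"
    by (rule self_adjoint_scalar_of_irreducible[OF irreducible T]) (simp_all add: lin normal)
  then obtain t where t: "\<And>x. \<i> *\<^sub>C (T x - ?T' x) = t *\<^sub>R x"
    by blast
  have "T x = (Complex s (- t) / 2) *\<^sub>C x" for x
  proof -
    have "T x - ?T' x = - \<i> *\<^sub>C (\<i> *\<^sub>C (T x - ?T' x))"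
      by (simp add: scaleC_scaleC)
    also have "\<dots> = (- \<i> * t) *\<^sub>C x"
      unfolding t by (simp add: scaleR_scaleC scaleC_scaleC)
    finally have W: "T x - ?T' x = (- \<i> * t) *\<^sub>C x" .
    have "T x = (1/2) *\<^sub>R ((T x + ?T' x) + (T x - ?T' x))"
      by (simp flip: scaleR_2)
    also have "\<dots> = (1/2 * (s - \<i> * t)) *\<^sub>C x"
      unfolding W s by (simp add: scaleR_scaleC scaleC_scaleC
          flip: scaleC_add_left complex_vector.scale_left_diff_distrib)
    finally show ?thesis
      by (simp add: complex_eq_iff Complex_eq)
  qed
  then show False
    using reducing_subspace_of_scalar[OF dim T] irreducible by blast
qed

section \<open>From the relations for \<open>P\<close> to a reducing subspace\<close>

text \<open>Let \<open>q\<close> be the quadratic form of \<open>D\<close>. If \<open>q\<close> is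
  positive at some \<open>x\<close>, its positivity at \<open>P x \<plusminus> x\<close> bounds
  \<open>1 / c\<close> by 2 in absolute value, so the polynomial of \<open>P\<close> has no two
  distinct real roots. A symmetric \<open>P\<close> is then a scalar with square 1, which is
  excluded.\<close>

lemma positive_fixed_by_quadratic_eq_0:
  fixes P D :: "'a::real_inner \<Rightarrow> 'a"
  assumes lin: "linear P" "linear D"
    and P_sym: "\<And>x y. inner (P x) y = inner x (P y)"
    and D_sym: "\<And>x y. inner (D x) y = inner x (D y)"
    and D_pos: "\<And>x. inner (D x) x \<ge> 0"
    and PDP: "\<And>x. P (D (P x)) = D x"
    and quadratic: "\<And>x. P x = c *\<^sub>R (x + P (P x))"
    and "P \<noteq> (\<lambda>x. x)" "P \<noteq> (\<lambda>x. - x)"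
  shows "D x = 0"
proof (cases "c = 0")
  case True
  then have "P x = 0" for x using quadratic by simp
  then show ?thesis using PDP[of x] by simp
next
  case c: False
  note lin_simps = linear_add[OF lin(1)] linear_diff[OF lin(1)] linear_scale[OF lin(1)]
    linear_add[OF lin(2)] linear_diff[OF lin(2)] linear_scale[OF lin(2)]
  have PP: "P (P x) = (1 / c) *\<^sub>R P x - x" for x
    using quadratic[of x] c by (metis add_diff_cancel_left' divide_inverse inverse_eq_divide
        mult_1 scaleR_one scaleR_scaleR left_inverse)
  have q_P: "inner (D (P x)) (P x) = inner (D x) x" for x
    using P_sym[of "D (P x)" x] PDP by simp
  have mixed: "2 * inner (D (P x)) x = inner (D x) x / c" for x
  proof -
    have "inner (D (P x)) x = inner (D (P (P x))) (P x)"
      using P_sym[of "D (P (P x))" x] PDP by simp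
    also have "\<dots> = inner (D x) x / c - inner (D (P x)) x"
      unfolding PP lin_simps using q_P[of x] D_sym[of x "P x"] inner_commute[of x "D (P x)"]
      by (simp add: inner_diff_left)
    finally show ?thesis by simp
  qed
  have q0: "inner (D x) x = 0" for x
  proof (rule ccontr)
    assume "inner (D x) x \<noteq> 0"
    then have q: "inner (D x) x > 0" using D_pos[of x] by simp
    \<comment> \<open>By \<open>q_P\<close> and \<open>mixed\<close>, \<open>q\<close> takes the
      values \<open>2 q(x) - q(x) / c\<close> at \<open>P x - x\<close> and
      \<open>2 q(x) + q(x) / c\<close> at \<open>P x + x\<close>; both are nonnegative.\<close>
    have comm: "inner (D x) (P x) = inner (D (P x)) x"
      using D_sym[of x "P x"] by (simp add: inner_commute)
    have "inner (D x) x / c \<le> 2 * inner (D x) x"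
      using D_pos[of "P x - x"] mixed[of x] q_P[of x] comm
      by (simp add: lin_simps inner_diff_left inner_diff_right)
    moreover have "- (inner (D x) x / c) \<le> 2 * inner (D x) x"
      using D_pos[of "P x + x"] mixed[of x] q_P[of x] comm
      by (simp add: lin_simps inner_add_left inner_add_right)
    ultimately have "inner (D x) x * (1 / c) \<le> inner (D x) x * 2"
        "inner (D x) x * (- (1 / c)) \<le> inner (D x) x * 2"
      by simp_all
    then have c_le: "\<bar>1 / c\<bar> \<le> 2"
      using q unfolding mult_le_cancel_left_pos[OF q] by linarith
    \<comment> \<open>The mean of the two roots of \<open>z^2 - z / c + 1\<close>. Completing the
      square gives \<open>(P - d)^2 = d^2 - 1 \<le> 0\<close>, while the square of a symmetric
      operator is nonnegative.\<close>
    define d where "d = 1 / (2 * c)"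
    have d: "\<bar>d\<bar> \<le> 1" using c_le by (simp add: d_def)
    then have d2: "d\<^sup>2 \<le> 1" by (simp add: abs_square_le_1)
    have sq: "(norm (P y - d *\<^sub>R y))\<^sup>2 = (d\<^sup>2 - 1) * (norm y)\<^sup>2" for y
    proof -
      have "inner (P y) (P y) = 2 * d * inner (P y) y - inner y y"
        using P_sym[of "P y" y] PP[of y] c by (simp add: d_def inner_diff_left)
      then show ?thesis
        unfolding power2_norm_eq_inner
        by (simp add: inner_diff_left inner_diff_right inner_commute algebra_simps power2_eq_square)
    qed
    have "P y = d *\<^sub>R y" for y
    proof -
      have "(norm (P y - d *\<^sub>R y))\<^sup>2 \<le> 0"
        unfolding sq using d2 by (simp add: mult_nonpos_nonneg)
      then show ?thesis by simp
    qed
    moreover have "d\<^sup>2 = 1"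
    proof -
      have "x \<noteq> 0" using q by auto
      then show ?thesis using sq[of x] calculation by simp
    qed
    ultimately show False
      using assms(8,9) by (auto simp: power2_eq_1_iff)
  qed
  \<comment> \<open>Polarization: expanding the vanishing form at \<open>x + D x\<close> leaves
    twice this inner product.\<close>
  have "inner (D x) (D x) = 0"
    using q0[of "x + D x"] q0[of x] q0[of "D x"] D_sym[of "D x" x]
    by (simp add: lin_simps inner_add_left inner_add_right inner_commute)
  then show ?thesis by simp
qed

text \<open>Formally \<open>W f(P) = f(P\<^sup>-\<^sup>1) W\<close> whenever \<open>P W P = W\<close>, so \<open>W\<close> commutes with \<open>f(P)\<close> for
  every \<open>f\<close> with \<open>f(t) = f(1/t)\<close>. The function \<open>f(t) = t / (1 + t\<^sup>2)\<close> is defined even when \<open>P\<close>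
  is not invertible.\<close>

lemma reducing_subspace_of_symmetry:
  fixes T :: "'a::chilbert_space \<Rightarrow> 'a"
  assumes dim: "\<not> finite_cdim TYPE('a)" and T: "hyponormal T" and P: "self_adjoint P"
    and X: "\<And>x. P (T x + cadjoint T x) = T (P x) + cadjoint T (P x)"
    and W: "\<And>x. P (T (P x) - cadjoint T (P x)) = T x - cadjoint T x"
    and "P \<noteq> (\<lambda>x. x)" "P \<noteq> (\<lambda>x. - x)"
  shows "\<exists>M. reducing_subspace T M \<and> M \<noteq> {0} \<and> M \<noteq> UNIV"
proof (rule ccontr)
  assume irreducible: "\<not> ?thesis"
  let ?T' = "cadjoint T"
  have clin: "bounded_clinear T" "bounded_clinear ?T'" "bounded_clinear P"
    using T P bounded_clinear_cadjoint by (auto simp: hyponormal_def self_adjoint_def)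
  note lin = bounded_clinearD[OF clin(1)] bounded_clinearD[OF clin(2)] bounded_clinearD[OF clin(3)]
  have adj: "inner (T x) y = inner x (?T' y)" "inner (?T' x) y = inner x (T y)" for x y
    using inner_cadjoint[OF clin(1)] by (auto simp: inner_commute)
  have P_sym: "inner (P x) y = inner x (P y)" for x y
    using P by (simp add: self_adjoint_iff)
  define X where "X x = T x + ?T' x" for x
  define W where "W x = T x - ?T' x" for x
  have PX: "P (X x) = X (P x)" for x using X by (simp add: X_def)
  have PWP: "P (W (P x)) = W x" for x using W by (simp add: W_def)
  have X_lin: "X (x + y) = X x + X y" and W_lin: "W (x + y) = W x + W y" for x y
    by (simp_all add: X_def W_def lin)
  have T_eq: "T x = (1/2) *\<^sub>R (X x + W x)" "?T' x = (1/2) *\<^sub>R (X x - W x)" for x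
    by (simp_all add: X_def W_def flip: scaleR_2)

  \<comment> \<open>The denominator \<open>1 + P^2\<close> is coercive, hence bijective and
    norm-increasing, so \<open>B = P G^(-1)\<close> is defined and bounded. Facts about
    \<open>B\<close> are checked on vectors \<open>G u\<close>, where
    \<open>B (G u) = P u\<close>.\<close>
  define G where "G u = u + P (P u)" for u
  have G_bl: "bounded_linear G"
    unfolding G_def
    by (intro bounded_linear_add bounded_linear_ident bounded_linear_compose[OF lin(13)] lin(13))
  have G_lin: "G (x + y) = G x + G y" "G (x - y) = G x - G y"
    "G (c *\<^sub>C x) = c *\<^sub>C G x" "G (r *\<^sub>R x) = r *\<^sub>R G x" for x y c r
    by (simp_all add: G_def lin scaleC_add_right scaleR_add_right)
  have G_ge: "(norm u)\<^sup>2 \<le> inner (G u) u" for u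
    using P_sym[of "P u" u] by (simp add: G_def inner_add_left power2_norm_eq_inner)
  have norm_G: "norm u \<le> norm (G u)" for u
  proof (cases "u = 0")
    case False
    have "norm u * norm u \<le> norm (G u) * norm u"
      using G_ge[of u] norm_cauchy_schwarz[of "G u" u] by (simp add: power2_eq_square)
    then show ?thesis using False by simp
  qed simp
  have surj: "\<exists>u. x = G u" for x
    using coercive_surj[OF G_bl G_ge] by (metis surjD)
  have inj: "inj G"
    by (rule injI) (metis G_lin(2) eq_iff_diff_eq_0 norm_G norm_le_zero_iff norm_zero)
  define B where "B x = P (inv G x)" for x
  have BG: "B (G u) = P u" for u
    using inj by (simp add: B_def)
  have GB: "G (B x) = P x" for x
    using surj[of x] BG by (auto simp: G_def lin)
  have BX: "B (X x) = X (B x)" for x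
  proof -
    obtain u where u: "x = G u" using surj by blast
    have "X (G u) = G (X u)" by (simp add: G_def X_lin PX)
    then show ?thesis by (simp add: u BG PX)
  qed
  have BW: "B (W x) = W (B x)" for x
  proof -
    obtain u where u: "x = G u" using surj by blast
    \<comment> \<open>From \<open>P W P = W\<close> come \<open>P W P^2 = W P\<close> and
      \<open>P^2 W P = P W\<close>, hence \<open>P W G = G W P\<close>. Since
      \<open>P = G B = B G\<close>, this is the commutation of \<open>B\<close> and \<open>W\<close>
      with \<open>G\<close> applied on both sides.\<close>
    have "P (W (G u)) = P (W u) + W (P u)"
      by (simp add: G_def W_lin lin PWP)
    also have "\<dots> = G (W (P u))"
      by (simp add: G_def PWP)
    finally have "G (B (W x)) = G (W (B x))"
      by (simp add: u BG GB)
    then show ?thesis using inj by (simp add: inj_eq)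
  qed
  have "bounded_linear B"
  proof -
    interpret P: bounded_linear P by (rule lin)
    obtain C where C: "C > 0" "\<And>x. norm (P x) \<le> norm x * C"
      using P.pos_bounded by blast
    show ?thesis
    proof (rule bounded_linear_intro)
      fix x y r
      obtain u v where uv: "x = G u" "y = G v" using surj by metis
      show "B (x + y) = B x + B y" "B (r *\<^sub>R x) = r *\<^sub>R B x"
        by (simp_all add: uv BG lin flip: G_lin)
      show "norm (B x) \<le> norm x * C"
        unfolding uv BG using C(1)
        by (intro order_trans[OF C(2)] mult_right_mono norm_G) simp
    qed
  qed
  moreover have "B (c *\<^sub>C x) = c *\<^sub>C B x" for c x
    using surj[of x] by (auto simp: BG lin simp flip: G_lin)
  moreover have "inner (B x) y = inner x (B y)" for x y
  proof -
    obtain u v where "x = G u" "y = G v" using surj by metis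
    then show ?thesis
      by (simp add: BG) (simp add: G_def P_sym inner_add_left inner_add_right)
  qed
  ultimately have "self_adjoint B"
    by (simp add: self_adjoint_iff bounded_clinear_iff)
  note B_lin = bounded_clinearD[OF conjunct1[OF this[unfolded self_adjoint_iff]]]
  from \<open>self_adjoint B\<close> have "\<exists>c. \<forall>x. B x = c *\<^sub>R x"
    by (rule self_adjoint_scalar_of_irreducible[OF irreducible clin(1)])
      (simp_all add: T_eq B_lin BX BW)
  then obtain c where c: "\<And>x. B x = c *\<^sub>R x"
    by blast
  have quadratic: "P x = c *\<^sub>R (x + P (P x))" for x
    using BG[of x] c[of "G x"] by (simp add: G_def)

  define D where "D x = ?T' (T x) - T (?T' x)" for x
  \<comment> \<open>The self-commutator is half the commutator of \<open>X\<close> and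
    \<open>W\<close>. As \<open>P\<close> commutes with \<open>X\<close> and
    \<open>P W P = W\<close>, this yields \<open>P D P = D\<close>.\<close>
  have D_eq: "D x = (1/2) *\<^sub>R (X (W x) - W (X x))" for x
  proof -
    have "X (W x) - W (X x) = 2 *\<^sub>R D x"
      by (simp add: D_def X_def W_def lin scaleR_2)
    then show ?thesis by simp
  qed
  have "D x = 0" for x
  proof (rule positive_fixed_by_quadratic_eq_0[of P D, OF _ _ P_sym _ _ _ quadratic])
    show "linear P" using lin(13) by (rule bounded_linear.linear)
    show "linear D" by (rule linearI) (simp_all add: D_def lin scaleR_diff_right)
    show "inner (D x) y = inner x (D y)" for x y
      by (simp add: D_def inner_diff_left inner_diff_right adj)
    show "inner (D x) x \<ge> 0" for x
      using T by (auto simp: hyponormal_def positive_semidefinite_def D_def inner_eq_Re_cinner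
          complex_nonneg_Reals_iff)
    show "P (D (P x)) = D x" for x
      by (simp add: D_eq lin PX PWP) (simp add: PWP flip: PX)
  qed (use assms in auto)
  then have "?T' (T x) = T (?T' x)" for x
    by (simp add: D_def)
  then show False
    using reducing_subspace_of_normal[OF dim clin(1)] irreducible by blast
qed

section \<open>Projections onto reducing subspaces and the equivalence\<close>

text \<open>Invariance of \<open>M\<close> under \<open>T\<close> puts \<open>T (Q x)\<close> into
  \<open>M\<close>, and invariance under the adjoint makes \<open>T (x - Q x)\<close> orthogonal to
  \<open>M\<close>; so \<open>T (Q x)\<close> is the projection of \<open>T x\<close>. For the
  adjoint the roles are exchanged.\<close>

lemma reducing_subspace_projection:
  assumes T: "bounded_clinear T" and M: "reducing_subspace T M"
  obtains Q where "self_adjoint Q" "\<And>x. Q x \<in> M" "\<And>x. x \<in> M \<Longrightarrow> Q x = x"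
    "\<And>x. T (Q x) = Q (T x)" "\<And>x. cadjoint T (Q x) = Q (cadjoint T x)"
proof -
  note T' = bounded_clinear_cadjoint[OF T]
  have M': "closed M" "subspace M" "\<And>c x. x \<in> M \<Longrightarrow> c *\<^sub>C x \<in> M"
    "\<And>x. x \<in> M \<Longrightarrow> T x \<in> M" "\<And>x. x \<in> M \<Longrightarrow> cadjoint T x \<in> M"
    using M by (auto simp: reducing_subspace_def complex_subspace_iff)
  have "\<exists>p. p \<in> M \<and> (\<forall>y\<in>M. inner (x - p) y = 0)" for x
    using orthogonal_projection_exists[OF M'(1,2)] by metis
  then obtain Q where Q: "\<And>x. Q x \<in> M" "\<And>x y. y \<in> M \<Longrightarrow> inner (x - Q x) y = 0"
    by metis
  \<comment> \<open>Uniqueness of the projection; linearity and both commutation relations follow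
    from it.\<close>
  have Q_eqI: "Q x = p" if "p \<in> M" "\<And>y. y \<in> M \<Longrightarrow> inner (x - p) y = 0" for x p
  proof -
    have "Q x - p \<in> M" using Q(1) that(1) M'(2) by (simp add: subspace_diff)
    then have "inner ((x - p) - (x - Q x)) (Q x - p) = 0"
      using Q(2) that(2) by (metis diff_self inner_diff_left)
    then show ?thesis by simp
  qed
  have sym: "inner (Q x) y = inner x (Q y)" for x y
    using Q(2)[OF Q(1), of x y] Q(2)[OF Q(1), of y x]
    by (simp add: inner_diff_left) (metis inner_commute)
  have add: "Q (x + y) = Q x + Q y" for x y
  proof (rule Q_eqI)
    show "Q x + Q y \<in> M"
      using Q(1) M'(2) by (simp add: subspace_add)
    show "inner (x + y - (Q x + Q y)) z = 0" if "z \<in> M" for z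
      using Q(2)[OF that, of x] Q(2)[OF that, of y] by (simp add: inner_diff_left inner_add_left)
  qed
  have scale: "Q (c *\<^sub>C x) = c *\<^sub>C Q x" for c x
  proof (rule Q_eqI)
    show "inner (c *\<^sub>C x - c *\<^sub>C Q x) y = 0" if "y \<in> M" for y
      using Q(2)[OF M'(3)[OF that, of "cnj c"], of x]
      by (simp add: inner_scaleC_left flip: complex_vector.scale_right_diff_distrib)
  qed (use Q(1) M'(3) in blast)
  have "bounded_linear Q"
  proof (rule bounded_linear_intro)
    show "Q (r *\<^sub>R x) = r *\<^sub>R Q x" for r x
      by (simp add: scaleR_scaleC scale)
    fix x
    have "norm (Q x) * norm (Q x) = inner x (Q x)"
      using Q(2)[OF Q(1), of x x]
      by (simp add: inner_diff_left flip: power2_norm_eq_inner power2_eq_square)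
    also have "\<dots> \<le> norm x * norm (Q x)" by (rule norm_cauchy_schwarz)
    finally show "norm (Q x) \<le> norm x * 1"
      by (cases "Q x = 0") auto
  qed (rule add)
  then have "self_adjoint Q"
    by (simp add: self_adjoint_iff bounded_clinear_iff sym scale)
  moreover have "T (Q x) = Q (T x)" for x
  proof (rule Q_eqI[symmetric])
    show "inner (T x - T (Q x)) y = 0" if "y \<in> M" for y
      using Q(2)[OF M'(5)[OF that], of x]
      by (simp add: inner_cadjoint[OF T] flip: bounded_clinearD(3)[OF T])
  qed (use Q(1) M'(4) in blast)
  moreover have "cadjoint T (Q x) = Q (cadjoint T x)" for x
  proof (rule Q_eqI[symmetric])
    show "inner (cadjoint T x - cadjoint T (Q x)) y = 0" if "y \<in> M" for y
      using Q(2)[OF M'(4)[OF that], of x] inner_cadjoint[OF T, of y "x - Q x"]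
      by (simp add: inner_commute flip: bounded_clinearD(3)[OF T'])
  qed (use Q(1) M'(5) in blast)
  moreover have "Q x = x" if "x \<in> M" for x
    by (rule Q_eqI[OF that]) simp
  ultimately show thesis using that Q(1) by blast
qed

theorem theorem4p6:
  fixes T :: "'a::chilbert_space \<Rightarrow> 'a"
  assumes "\<not> finite_cdim TYPE('a)"
    and "separable TYPE('a)"
    and "hyponormal T"
  shows "(\<exists>M. reducing_subspace T M \<and> M \<noteq> {0} \<and> M \<noteq> UNIV) \<longleftrightarrow>
    (\<exists>Q\<in>S_set T. self_adjoint Q \<and> Q \<noteq> (\<lambda>x. 0) \<and> Q \<noteq> id \<and>
      Q \<circ> real_part T = real_part T \<circ> Q)"
proof
  have T: "bounded_clinear T" using assms(3) by (simp add: hyponormal_def)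
  assume "\<exists>M. reducing_subspace T M \<and> M \<noteq> {0} \<and> M \<noteq> UNIV"
  then obtain M where M: "reducing_subspace T M" "M \<noteq> {0}" "M \<noteq> UNIV" by blast
  from T M(1) obtain Q where Q: "self_adjoint Q" "\<And>x. Q x \<in> M" "\<And>x. x \<in> M \<Longrightarrow> Q x = x"
    "\<And>x. T (Q x) = Q (T x)" "\<And>x. cadjoint T (Q x) = Q (cadjoint T x)"
    using reducing_subspace_projection by blast
  have clin: "bounded_clinear Q" using Q(1) by (simp add: self_adjoint_def)
  \<comment> \<open>\<open>T (Q x) = Q (T x)\<close> lies in \<open>M\<close>, where
    \<open>1 - Q\<close> vanishes.\<close>
  have "(\<lambda>x. x - Q x) \<circ> T \<circ> Q = (\<lambda>x. 0)"
    using Q by (auto simp: fun_eq_iff)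
  moreover have "self_adjoint (\<lambda>x::'a. 0)"
    by (simp add: self_adjoint_iff bounded_clinear_iff)
  ultimately have "Q \<in> S_set T"
    using clin by (simp add: S_set_def)
  moreover have "Q \<noteq> id" using Q(2) M(3) by auto
  moreover have "Q \<noteq> (\<lambda>x. 0)"
  proof
    assume "Q = (\<lambda>x. 0)"
    then have "M = {0}" using Q(2,3) by fastforce
    then show False using M(2) by blast
  qed
  moreover have "Q \<circ> real_part T = real_part T \<circ> Q"
    by (auto simp: fun_eq_iff real_part_def bounded_clinearD[OF clin] Q)
  ultimately show "\<exists>Q\<in>S_set T. self_adjoint Q \<and> Q \<noteq> (\<lambda>x. 0) \<and> Q \<noteq> id \<and>
      Q \<circ> real_part T = real_part T \<circ> Q"
    using Q(1) by blast
next
  assume "\<exists>Q\<in>S_set T. self_adjoint Q \<and> Q \<noteq> (\<lambda>x. 0) \<and> Q \<noteq> id \<and>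
      Q \<circ> real_part T = real_part T \<circ> Q"
  then obtain Q where Q: "Q \<in> S_set T" "self_adjoint Q" "Q \<noteq> (\<lambda>x. 0)" "Q \<noteq> id"
    "Q \<circ> real_part T = real_part T \<circ> Q"
    by blast
  let ?T' = "cadjoint T"
  have clin: "bounded_clinear T" "bounded_clinear ?T'" "bounded_clinear Q"
    using assms(3) Q(2) bounded_clinear_cadjoint by (auto simp: hyponormal_def self_adjoint_def)
  note lin = bounded_clinearD[OF clin(1)] bounded_clinearD[OF clin(2)] bounded_clinearD[OF clin(3)]
  have adj: "inner (T x) y = inner x (?T' y)" for x y
    by (rule inner_cadjoint[OF clin(1)])
  have Q_sym: "inner (Q x) y = inner x (Q y)" for x y
    using Q(2) by (simp add: self_adjoint_iff)
  \<comment> \<open>Self-adjointness of \<open>(1 - Q) T Q\<close> written out: it equals its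
    adjoint \<open>Q T* (1 - Q)\<close>.\<close>
  have S: "T (Q x) - Q (T (Q x)) = Q (?T' x) - Q (?T' (Q x))" for x
  proof -
    have "inner y (T (Q x) - Q (T (Q x))) = inner y (Q (?T' x) - Q (?T' (Q x)))" for y
    proof -
      have "inner y (T (Q x) - Q (T (Q x))) = inner (T (Q y) - Q (T (Q y))) x"
        using Q(1) by (simp add: S_set_def self_adjoint_iff)
      also have "\<dots> = inner y (Q (?T' x) - Q (?T' (Q x)))"
        by (simp add: inner_diff_left inner_diff_right Q_sym adj)
      finally show ?thesis .
    qed
    then show ?thesis using vector_eq_ldot by blast
  qed
  have "(1/2) *\<^sub>C Q (T x + ?T' x) = (1/2) *\<^sub>C (T (Q x) + ?T' (Q x))" for x
    using fun_cong[OF Q(5), of x] by (simp add: real_part_def lin)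
  then have X: "Q (T x) + Q (?T' x) = T (Q x) + ?T' (Q x)" for x
    by (simp add: lin)
  define P where "P x = 2 *\<^sub>R Q x - x" for x
  have "P (c *\<^sub>C x) = c *\<^sub>C P x" for c x
    by (simp add: P_def lin complex_vector.scale_right_diff_distrib scaleR_scaleC scaleC_scaleC
        mult.commute)
  moreover have "bounded_linear P"
    unfolding P_def
    by (intro bounded_linear_sub bounded_linear_ident
        bounded_linear_compose[OF bounded_linear_scaleR_right] lin)
  moreover have "inner (P x) y = inner x (P y)" for x y
    by (simp add: P_def inner_diff_left inner_diff_right Q_sym)
  ultimately have P: "self_adjoint P"
    by (simp add: self_adjoint_iff bounded_clinear_iff)
  show "\<exists>M. reducing_subspace T M \<and> M \<noteq> {0} \<and> M \<noteq> UNIV"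
  proof (rule reducing_subspace_of_symmetry[OF assms(1,3) P])
    show "P (T x + ?T' x) = T (P x) + ?T' (P x)" for x
      using X[of x] by (simp add: P_def lin algebra_simps flip: scaleR_add_right)
    show "P (T (P x) - ?T' (P x)) = T x - ?T' x" for x
    proof -
      \<comment> \<open>Twice \<open>S\<close> plus \<open>X\<close> yields
        \<open>2 Q W Q = Q W + W Q\<close> with \<open>W = T - T*\<close>. Hence in
        \<open>(2 Q - 1) W (2 Q - 1) = 4 Q W Q - 2 Q W - 2 W Q + W\<close> all terms but the last
        cancel.\<close>
      have "2 *\<^sub>R Q (T (Q x) - ?T' (Q x)) = Q (T x - ?T' x) + (T (Q x) - ?T' (Q x))"
      proof -
        have "2 *\<^sub>R (T (Q x) - Q (T (Q x))) + (Q (T x) + Q (?T' x))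
            = 2 *\<^sub>R (Q (?T' x) - Q (?T' (Q x))) + (T (Q x) + ?T' (Q x))"
          by (simp only: S X)
        then show ?thesis by (simp add: lin scaleR_2 algebra_simps)
      qed
      then have "4 *\<^sub>R Q (T (Q x) - ?T' (Q x))
          = 2 *\<^sub>R (Q (T x - ?T' x) + (T (Q x) - ?T' (Q x)))"
        by (metis mult_2 numeral_Bit0 numeral_times_numeral scaleR_scaleR semiring_norm(12,13))
      then show ?thesis by (simp add: P_def lin algebra_simps)
    qed
    show "P \<noteq> (\<lambda>x. x)"
    proof
      assume "P = (\<lambda>x. x)"
      then have "2 *\<^sub>R Q x = 2 *\<^sub>R x" for x
        unfolding P_def by (metis diff_add_cancel scaleR_2)
      then show False using Q(4) by (auto simp: fun_eq_iff)
    qed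
    show "P \<noteq> (\<lambda>x. - x)"
    proof
      assume "P = (\<lambda>x. - x)"
      then have "2 *\<^sub>R Q x = 0" for x
        by (simp add: P_def fun_eq_iff)
      then show False using Q(3) by (auto simp: fun_eq_iff)
    qed
  qed
qed

end
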